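(* If $D$ is a connected two-way two-step dominating set in a finite simple graph $G$, then $$ rc(G) \leq rc(G[D]) + 6. $$
   Context: An edge-coloured graph is rainbow connected if every pair of vertices is joined by a path no two of whose edges have the same colour; $rc(H)$ is the minimum number of colours in an edge colouring making the connected graph $H$ rainbow connected. For $S\subseteq V(G)$, $N^k(S)$ is the set of vertices at distance exactly $k$ from $S$. A set $D$ is a two-step dominating set if every vertex is at distance at most $2$ from $D$; it is connected if $G[D]$ is connected. A (connected) two-step dominating set $D$ is a (connected) two-way two-step dominating set if (i) every pendant (degree-$1$) vertex of $G$ belongs to $D$, and (ii) every vertex of $N^2(D)$ has at least two neighbours in $N^1(D)$. *)

theory Defs
  imports Main "HOL-Library.Extended_Nat"
begin

record 'a graph =
  verts :: "'a set"
  edges :: "'a set set"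

definition finite_simple_graph :: "'a graph \<Rightarrow> bool" where
  "finite_simple_graph G \<longleftrightarrow>
     finite (verts G) \<and> (\<forall>e\<in>edges G. e \<subseteq> verts G \<and> card e = 2)"

definition induced_subgraph :: "'a graph \<Rightarrow> 'a set \<Rightarrow> 'a graph" where
  "induced_subgraph G S = \<lparr>verts = S, edges = {e \<in> edges G. e \<subseteq> S}\<rparr>"

definition neighbours :: "'a graph \<Rightarrow> 'a \<Rightarrow> 'a set" where
  "neighbours G v = {w \<in> verts G. {v, w} \<in> edges G}"

definition degree :: "'a graph \<Rightarrow> 'a \<Rightarrow> nat" where
  "degree G v = card (neighbours G v)"

definition path_edges :: "'a list \<Rightarrow> 'a set list" where
  "path_edges p = map (\<lambda>(x, y). {x, y}) (zip p (tl p))"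

text \<open>A path is the nonempty list of its pairwise distinct vertices; a single vertex is the path
  of length 0 from that vertex to itself.\<close>

definition is_path :: "'a graph \<Rightarrow> 'a \<Rightarrow> 'a list \<Rightarrow> 'a \<Rightarrow> bool" where
  "is_path G u p v \<longleftrightarrow>
     p \<noteq> [] \<and> hd p = u \<and> last p = v \<and> distinct p \<and>
     set p \<subseteq> verts G \<and> set (path_edges p) \<subseteq> edges G"

definition connected_graph :: "'a graph \<Rightarrow> bool" where
  "connected_graph G \<longleftrightarrow> (\<forall>u\<in>verts G. \<forall>v\<in>verts G. \<exists>p. is_path G u p v)"

text \<open>Distances are infinite when there is no path, or when the set is empty.\<close>

definition graph_dist :: "'a graph \<Rightarrow> 'a \<Rightarrow> 'a \<Rightarrow> enat" where
  "graph_dist G u v = (INF p\<in>{p. is_path G u p v}. enat (length (path_edges p)))"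

definition set_dist :: "'a graph \<Rightarrow> 'a set \<Rightarrow> 'a \<Rightarrow> enat" where
  "set_dist G S v = (INF u\<in>S. graph_dist G u v)"

definition dist_nbhd :: "'a graph \<Rightarrow> nat \<Rightarrow> 'a set \<Rightarrow> 'a set" where
  "dist_nbhd G k S = {v \<in> verts G. set_dist G S v = enat k}"

definition rainbow_connected :: "'a graph \<Rightarrow> ('a set \<Rightarrow> 'c) \<Rightarrow> bool" where
  "rainbow_connected G c \<longleftrightarrow>
     (\<forall>u\<in>verts G. \<forall>v\<in>verts G. \<exists>p. is_path G u p v \<and> distinct (map c (path_edges p)))"

text \<open>The colours are natural numbers, and only the colours of edges matter. The infimum is a
  minimum for finite connected graphs, and is infinite for disconnected graphs.\<close>

definition rc :: "'a graph \<Rightarrow> enat" where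
  "rc G = (INF k\<in>{k. \<exists>c :: 'a set \<Rightarrow> nat. c ` edges G \<subseteq> {..<k} \<and> rainbow_connected G c}. enat k)"

definition two_step_dominating :: "'a graph \<Rightarrow> 'a set \<Rightarrow> bool" where
  "two_step_dominating G D \<longleftrightarrow> D \<subseteq> verts G \<and> (\<forall>v\<in>verts G. set_dist G D v \<le> 2)"

definition two_way_two_step_dominating :: "'a graph \<Rightarrow> 'a set \<Rightarrow> bool" where
  "two_way_two_step_dominating G D \<longleftrightarrow>
     two_step_dominating G D \<and>
     (\<forall>v\<in>verts G. degree G v = 1 \<longrightarrow> v \<in> D) \<and>
     (\<forall>v\<in>dist_nbhd G 2 D. card (neighbours G v \<inter> dist_nbhd G 1 D) \<ge> 2)"

definition connected_two_way_two_step_dominating :: "'a graph \<Rightarrow> 'a set \<Rightarrow> bool" where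
  "connected_two_way_two_step_dominating G D \<longleftrightarrow>
     two_way_two_step_dominating G D \<and> connected_graph (induced_subgraph G D)"

end

theory Submission imports Defs begin

text \<open>
  Let \<open>N\<^sub>1\<close> and \<open>N\<^sub>2\<close> be the sets of vertices at distance 1 and 2 from \<open>D\<close>. Call two vertices of
  \<open>N\<^sub>1\<close> linked if they are adjacent or have a common neighbour in \<open>N\<^sub>2\<close>, and let \<open>X\<close> be a maximal
  independent set of the link graph: every vertex with a link then has a link across the partition
  of \<open>N\<^sub>1\<close> into \<open>X\<close> and its complement. Keep an optimal colouring of \<open>G[D]\<close> and add the colours
  0, ..., 5 as follows. Edges from \<open>N\<^sub>1\<close> to \<open>D\<close> get 0 at vertices of \<open>X\<close> and 1 at the others,
  except that a vertex without links, which has at least two neighbours in \<open>D\<close>, gets both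
  colours. Edges inside \<open>N\<^sub>1\<close> get 2. A vertex of \<open>N\<^sub>2\<close> with neighbours on both sides sends 2 to \<open>X\<close>
  and 3 to the other side; any other vertex of \<open>N\<^sub>2\<close> sends 4 to one neighbour in \<open>N\<^sub>1\<close> and 5 to
  the rest.

  Each vertex then reaches \<open>D\<close> along two rainbow walks whose new colours lie respectively in
  \<open>{0,4}\<close> and \<open>{1,2,3,5}\<close>, or in \<open>{0,2,3,4}\<close> and \<open>{1,5}\<close>, or in \<open>{0,2}\<close> and \<open>{1,3}\<close>. For any two
  vertices one can choose walks with disjoint colour sets and join them by a rainbow path in \<open>G[D]\<close>.
\<close>

section \<open>Rainbow walks\<close>

text \<open>\<open>S\<close> is a budget: each step spends the colour of its edge, so the walk is
  rainbow by construction and \<open>S\<close> only bounds the colours used. Vertices may repeat, so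
  walks with disjoint budgets concatenate freely.\<close>

inductive rainbow_walk :: "'a graph \<Rightarrow> ('a set \<Rightarrow> 'c) \<Rightarrow> 'a \<Rightarrow> 'c set \<Rightarrow> 'a \<Rightarrow> bool"
  for G c where
  refl: "u \<in> verts G \<Longrightarrow> rainbow_walk G c u S u"
| step: "u \<in> verts G \<Longrightarrow> {u, w} \<in> edges G \<Longrightarrow> c {u, w} \<in> S \<Longrightarrow>
    rainbow_walk G c w (S - {c {u, w}}) v \<Longrightarrow> rainbow_walk G c u S v"

lemma rainbow_walk_verts:
  assumes "rainbow_walk G c u S v"
  shows "u \<in> verts G" "v \<in> verts G"
  using assms by (induction rule: rainbow_walk.induct) auto

lemma rainbow_walk_mono:
  assumes "rainbow_walk G c u S v" "S \<subseteq> T"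
  shows "rainbow_walk G c u T v"
  using assms
proof (induction arbitrary: T rule: rainbow_walk.induct)
  case (step u w S v)
  have "rainbow_walk G c w (T - {c {u, w}}) v"
    using step.prems by (intro step.IH) auto
  then show ?case
    using step by (intro rainbow_walk.step[of u G w]) auto
qed (rule rainbow_walk.refl)

lemma rainbow_walk_trans:
  assumes "rainbow_walk G c u S v" "rainbow_walk G c v T w" "S \<inter> T = {}"
  shows "rainbow_walk G c u (S \<union> T) w"
  using assms
proof (induction rule: rainbow_walk.induct)
  case (refl u S)
  then show ?case by (auto intro: rainbow_walk_mono)
next
  case (step u x S v)
  have "rainbow_walk G c x ((S - {c {u, x}}) \<union> T) w"
    using step.prems by (intro step.IH) auto
  moreover have "(S - {c {u, x}}) \<union> T = (S \<union> T) - {c {u, x}}"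
    using step by auto
  ultimately show ?case
    using step by (intro rainbow_walk.step[of u G x]) auto
qed

lemma rainbow_walk_sym:
  assumes "rainbow_walk G c u S v"
  shows "rainbow_walk G c v S u"
  using assms
proof (induction rule: rainbow_walk.induct)
  case (step u w S v)
  have "w \<in> verts G"
    using rainbow_walk_verts[OF step.IH] by simp
  \<comment> \<open>The reversed first edge spends exactly the colour that was removed from the
    budget of the rest.\<close>
  then have "rainbow_walk G c w {c {u, w}} u"
    using step by (intro rainbow_walk.step[of w G u]) (auto simp: insert_commute intro: rainbow_walk.refl)
  with step.IH have "rainbow_walk G c v ((S - {c {u, w}}) \<union> {c {u, w}}) u"
    by (rule rainbow_walk_trans) auto
  then show ?case
    using step by (simp add: insert_absorb)
qed (rule rainbow_walk.refl)

lemma path_edges_simps [simp]: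
  "path_edges [] = []"
  "path_edges [x] = []"
  "path_edges (x # y # p) = {x, y} # path_edges (y # p)"
  by (simp_all add: path_edges_def)

lemma path_edges_append_Cons:
  "\<exists>es. path_edges (xs @ y # ys) = es @ path_edges (y # ys)"
proof (induction xs)
  case (Cons x xs)
  then show ?case
    by (cases xs) (auto intro: exI[of _ "_ # _"])
qed simp

lemma length_path_edges [simp]: "length (path_edges p) = length p - 1"
  by (simp add: path_edges_def)

lemma rainbow_walk_imp_path:
  assumes "rainbow_walk G c u S v"
  shows "\<exists>p. is_path G u p v \<and> distinct (map c (path_edges p)) \<and> c ` set (path_edges p) \<subseteq> S"
  using assms
proof (induction rule: rainbow_walk.induct)
  case (refl u S)
  then show ?case by (intro exI[of _ "[u]"]) (simp add: is_path_def)
next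
  case (step u w S v)
  then obtain p where p: "is_path G w p v" "distinct (map c (path_edges p))"
    "c ` set (path_edges p) \<subseteq> S - {c {u, w}}" by blast
  show ?case
  proof (cases "u \<in> set p")
    \<comment> \<open>The loop before the recurrence of \<open>u\<close> is dropped; the remaining
      edges form a suffix of the old ones and keep distinct colours.\<close>
    case True
    then obtain xs ys where xs: "p = xs @ u # ys"
      by (auto simp: in_set_conv_decomp)
    obtain es where es: "path_edges p = es @ path_edges (u # ys)"
      using path_edges_append_Cons[of xs u ys] xs by auto
    have "is_path G u (u # ys) v"
      using p(1) xs es unfolding is_path_def by auto
    then show ?thesis
      using p es by (intro exI[of _ "u # ys"]) auto
  next
    case False
    obtain q where "p = w # q"
      using p(1) by (cases p) (auto simp: is_path_def)
    then show ?thesis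
      using p step.hyps False by (intro exI[of _ "u # p"]) (auto simp: is_path_def)
  qed
qed

lemma rainbow_path_imp_walk:
  assumes "p \<noteq> []" "set p \<subseteq> verts G" "set (path_edges p) \<subseteq> edges G"
    "distinct (map c (path_edges p))"
  shows "rainbow_walk G c (hd p) (c ` set (path_edges p)) (last p)"
  using assms
proof (induction p rule: induct_list012)
  case (2 x)
  then show ?case by (auto intro: rainbow_walk.refl)
next
  case (3 x y p)
  then have *: "rainbow_walk G c y (c ` set (path_edges (y # p))) (last (y # p))"
    by simp
  have "rainbow_walk G c y (c ` set (path_edges (x # y # p)) - {c {x, y}}) (last (y # p))"
    using 3 by (intro rainbow_walk_mono[OF *]) auto
  then show ?case
    using 3 by (auto intro: rainbow_walk.step[of x G y])
qed simp

section \<open>Distance neighbourhoods\<close>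

text \<open>The empty infimum is infinite, so a finite value forces a nonempty index set; by
  well-ordering the infimum is then a least element.\<close>

lemma INF_enat_attained:
  fixes f :: "'b \<Rightarrow> enat"
  assumes "(INF x\<in>A. f x) = enat n"
  shows "\<exists>x\<in>A. f x = enat n"
proof -
  have ne: "f ` A \<noteq> {}"
    using assms by (auto simp: top_enat_def)
  then have "(LEAST y. y \<in> f ` A) \<in> f ` A"
    by (metis LeastI_ex ex_in_conv)
  then show ?thesis
    using assms ne by (auto simp: Inf_enat_def)
qed

lemma set_dist_attained:
  assumes "set_dist G S v = enat n"
  shows "\<exists>u\<in>S. \<exists>p. is_path G u p v \<and> length p = Suc n"
proof -
  obtain u where u: "u \<in> S" "graph_dist G u v = enat n"
    using INF_enat_attained assms unfolding set_dist_def by metis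
  then obtain p where "is_path G u p v" "length p - 1 = n"
    using INF_enat_attained[of "\<lambda>p. enat (length (path_edges p))"]
    unfolding graph_dist_def by fastforce
  \<comment> \<open>Truncated subtraction gives 0 for the empty list too; splitting \<open>p\<close>
    excludes that case.\<close>
  then show ?thesis
    using u by (intro bexI[of _ u] exI[of _ p]) (cases p, auto simp: is_path_def)
qed

lemma set_dist_eq_0_iff:
  assumes "v \<in> verts G"
  shows "set_dist G S v = 0 \<longleftrightarrow> v \<in> S"
proof
  assume "set_dist G S v = 0"
  then obtain u p where "u \<in> S" "is_path G u p v" "length p = Suc 0"
    using set_dist_attained[of G S v 0] by (auto simp: zero_enat_def)
  then show "v \<in> S"
    by (auto simp: is_path_def length_Suc_conv)
next
  assume v: "v \<in> S"
  have "graph_dist G v v \<le> enat (length (path_edges [v]))"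
    unfolding graph_dist_def using assms by (intro INF_lower) (simp add: is_path_def)
  then have "graph_dist G v v = 0"
    by (simp add: zero_enat_def[symmetric])
  moreover have "set_dist G S v \<le> graph_dist G v v"
    unfolding set_dist_def using v by (rule INF_lower)
  ultimately show "set_dist G S v = 0" by simp
qed

lemma dist_nbhd_1_adjacent:
  assumes "v \<in> dist_nbhd G 1 S"
  shows "\<exists>u\<in>S. {v, u} \<in> edges G"
proof -
  obtain u p where "u \<in> S" "is_path G u p v" "length p = Suc (Suc 0)"
    using set_dist_attained[of G S v 1] assms by (auto simp: dist_nbhd_def)
  then show ?thesis
    by (intro bexI[of _ u]) (auto simp: is_path_def length_Suc_conv insert_commute)
qed

lemma dist_nbhd_disjoint:
  assumes "k \<noteq> 0"
  shows "dist_nbhd G k S \<inter> S = {}"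
proof -
  have "v \<notin> S" if "v \<in> dist_nbhd G k S" for v
    using that set_dist_eq_0_iff[of v G S] assms by (auto simp: dist_nbhd_def zero_enat_def)
  then show ?thesis by blast
qed

lemma two_step_dominating_verts:
  assumes "two_step_dominating G D"
  shows "verts G = D \<union> dist_nbhd G 1 D \<union> dist_nbhd G 2 D"
proof
  show "verts G \<subseteq> D \<union> dist_nbhd G 1 D \<union> dist_nbhd G 2 D"
  proof
    fix v assume v: "v \<in> verts G"
    then have "set_dist G D v \<le> enat 2"
      using assms by (simp add: two_step_dominating_def numeral_eq_enat)
    then obtain n where n: "set_dist G D v = enat n" "n \<le> 2"
      by (cases "set_dist G D v") auto
    then consider "n = 0" | "n = 1" | "n = 2" by linarith
    then show "v \<in> D \<union> dist_nbhd G 1 D \<union> dist_nbhd G 2 D"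
      using n v set_dist_eq_0_iff[OF v, of D] by cases (auto simp: dist_nbhd_def zero_enat_def)
  qed
qed (use assms in \<open>auto simp: two_step_dominating_def dist_nbhd_def\<close>)

lemma two_distinct_elements:
  assumes "card A \<ge> 2"
  shows "\<exists>x\<in>A. x \<noteq> w"
proof (rule ccontr)
  assume "\<not> ?thesis"
  then have "A \<subseteq> {w}" by auto
  then have "card A \<le> card {w}" by (intro card_mono) auto
  then show False using assms by simp
qed

section \<open>The colouring\<close>

text \<open>To an independent set maximal under inclusion, a vertex without neighbours in it could
  still be added.\<close>

lemma maximal_independent_set:
  assumes "finite V" "\<And>x y. H x y \<Longrightarrow> H y x" "\<And>x. \<not> H x x"
  shows "\<exists>X\<subseteq>V. (\<forall>x\<in>X. \<forall>y\<in>X. \<not> H x y) \<and> (\<forall>v\<in>V - X. \<exists>x\<in>X. H v x)"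
proof -
  define I where "I = {X. X \<subseteq> V \<and> (\<forall>x\<in>X. \<forall>y\<in>X. \<not> H x y)}"
  have "I \<subseteq> Pow V" by (auto simp: I_def)
  then have "finite I"
    using assms(1) by (meson finite_Pow_iff finite_subset)
  moreover have "I \<noteq> {}" by (auto simp: I_def)
  ultimately obtain X where X: "X \<in> I" and max: "\<And>Y. Y \<in> I \<Longrightarrow> X \<subseteq> Y \<Longrightarrow> X = Y"
    using finite_has_maximal[of I] by metis
  have "\<exists>x\<in>X. H v x" if "v \<in> V - X" for v
  proof (rule ccontr)
    assume no: "\<not> ?thesis"
    then have "insert v X \<in> I"
      using X that assms(2,3) unfolding I_def by blast
    then show False
      using max[of "insert v X"] that by blast
  qed
  then show ?thesis
    using X by (intro exI[of _ X]) (auto simp: I_def)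
qed

text \<open>The distance layers become a partition with adjacency conditions;
  \<open>nonpendant\<close> and \<open>two_way\<close> are the source of second routes to
  \<open>D\<close>.\<close>

lemma layered_rainbow_colouring:
  fixes c :: "'a set \<Rightarrow> nat"
  assumes verts: "verts G = D \<union> N1 \<union> N2"
    and disj: "D \<inter> N1 = {}" "D \<inter> N2 = {}" "N1 \<inter> N2 = {}"
    and fin: "finite N1"
    and simple: "\<And>e. e \<in> edges G \<Longrightarrow> e \<subseteq> verts G \<and> card e = 2"
    and foot_ex: "\<And>v. v \<in> N1 \<Longrightarrow> \<exists>d\<in>D. {v, d} \<in> edges G"
    and nonpendant: "\<And>v w. v \<in> N1 \<Longrightarrow> \<exists>x. x \<noteq> w \<and> {v, x} \<in> edges G"
    and two_way: "\<And>u w. u \<in> N2 \<Longrightarrow> \<exists>x\<in>N1. x \<noteq> w \<and> {u, x} \<in> edges G"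
    and c: "c ` edges (induced_subgraph G D) \<subseteq> {..<k}" "rainbow_connected (induced_subgraph G D) c"
  shows "\<exists>c' :: 'a set \<Rightarrow> nat. c' ` edges G \<subseteq> {..<k + 6} \<and> rainbow_connected G c'"
proof -

  \<comment> \<open>The link graph and its maximal independent set\<close>
  define H where "H a b \<longleftrightarrow> a \<in> N1 \<and> b \<in> N1 \<and> a \<noteq> b \<and>
    ({a, b} \<in> edges G \<or> (\<exists>u\<in>N2. {u, a} \<in> edges G \<and> {u, b} \<in> edges G))" for a b
  have H_sym: "H b a" if "H a b" for a b
    using that by (auto simp: H_def insert_commute)
  have H_irrefl: "\<not> H a a" for a
    by (simp add: H_def)
  have H_N1: "a \<in> N1" "b \<in> N1" if "H a b" for a b
    using that by (simp_all add: H_def)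
  obtain X where X: "X \<subseteq> N1" and indep: "\<And>x y. x \<in> X \<Longrightarrow> y \<in> X \<Longrightarrow> \<not> H x y"
    and dom: "\<And>v. v \<in> N1 - X \<Longrightarrow> \<exists>x\<in>X. H v x"
    using maximal_independent_set[of N1 H, OF fin H_sym H_irrefl] by metis
  \<comment> \<open>From inside \<open>X\<close>, independence makes every link leave
    \<open>X\<close>; from outside, domination supplies one entering it.\<close>
  have cross: "\<exists>w. H v w \<and> (w \<in> X \<longleftrightarrow> v \<notin> X)" if "H v w0" for v w0
    using that indep[of v w0] dom[of v] H_N1[OF that] by (cases "v \<in> X") auto

  \<comment> \<open>The six additional colours\<close>
  define foot where "foot v = (SOME d. d \<in> D \<and> {v, d} \<in> edges G)" for v
  have foot: "foot v \<in> D" "{v, foot v} \<in> edges G" if "v \<in> N1" for v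
    using someI_ex[of "\<lambda>d. d \<in> D \<and> {v, d} \<in> edges G"] foot_ex[OF that]
    unfolding foot_def by blast+
  define anchor where "anchor u = (SOME x. x \<in> N1 \<and> {u, x} \<in> edges G)" for u
  have anchor: "anchor u \<in> N1" "{u, anchor u} \<in> edges G" if "u \<in> N2" for u
    using someI_ex[of "\<lambda>x. x \<in> N1 \<and> {u, x} \<in> edges G"] two_way[OF that]
    unfolding anchor_def by blast+
  define leg :: "'a \<Rightarrow> 'a \<Rightarrow> nat" where
    "leg v d = (if \<exists>w. H v w then if v \<in> X then 0 else 1 else if d = foot v then 0 else 1)" for v d
  define mixed where "mixed u \<longleftrightarrow>
    (\<exists>x\<in>X. {u, x} \<in> edges G) \<and> (\<exists>y\<in>N1 - X. {u, y} \<in> edges G)" for u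
  define up :: "'a \<Rightarrow> 'a \<Rightarrow> nat" where
    "up u x = (if mixed u then if x \<in> X then 2 else 3 else if x = anchor u then 4 else 5)" for u x
  \<comment> \<open>\<open>the_elem\<close> picks the intended endpoint on edges joining
    \<open>D\<close> to \<open>N1\<close> or \<open>N1\<close> to \<open>N2\<close>. On other edges
    its value may be arbitrary, but \<open>leg\<close> and \<open>up\<close> never exceed 5, so the
    palette still fits.\<close>
  define c' where "c' e = (if e \<subseteq> D then c e else k +
    (if e \<inter> D \<noteq> {} then leg (the_elem (e \<inter> N1)) (the_elem (e \<inter> D))
     else if e \<inter> N2 \<noteq> {} then up (the_elem (e \<inter> N2)) (the_elem (e \<inter> N1)) else 2))" for e
  have c'_D: "c' e = c e" if "e \<subseteq> D" for e
    using that by (simp add: c'_def)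
  have c'_leg: "c' {v, d} = k + leg v d" if "v \<in> N1" "d \<in> D" for v d
  proof -
    have "{v, d} \<inter> N1 = {v}" "{v, d} \<inter> D = {d}" "\<not> {v, d} \<subseteq> D"
      using that disj by blast+
    then show ?thesis by (auto simp: c'_def)
  qed
  have c'_up: "c' {u, x} = k + up u x" if "u \<in> N2" "x \<in> N1" for u x
  proof -
    have "{u, x} \<inter> N1 = {x}" "{u, x} \<inter> N2 = {u}" "\<not> {u, x} \<subseteq> D" "{u, x} \<inter> D = {}"
      using that disj by blast+
    then show ?thesis by (auto simp: c'_def)
  qed
  have c'_N1: "c' {v, w} = k + 2" if "v \<in> N1" "w \<in> N1" for v w
  proof -
    have "{v, w} \<inter> N2 = {}" "{v, w} \<inter> D = {}" "\<not> {v, w} \<subseteq> D"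
      using that disj by blast+
    then show ?thesis by (auto simp: c'_def)
  qed
  have range: "c' e < k + 6" if "e \<in> edges G" for e
    using that c(1) by (fastforce simp: c'_def leg_def up_def induced_subgraph_def)

  \<comment> \<open>\<open>S\<close> holds colours relative to the offset \<open>k\<close>, which
    keeps them apart from the colours below \<open>k\<close> used inside \<open>D\<close>.\<close>
  define R where "R v S \<longleftrightarrow> (\<exists>d\<in>D. rainbow_walk G c' v ((+) k ` S) d)" for v S
  have R_mono: "R v T" if "R v S" "S \<subseteq> T" for v S T
    using that rainbow_walk_mono[OF _ image_mono] unfolding R_def by metis
  have R_D: "R d S" if "d \<in> D" for d S
    using that verts by (auto simp: R_def intro: rainbow_walk.refl)
  have R_step: "R v S"
    if step: "{v, w} \<in> edges G" "c' {v, w} = k + a" "R w T" "a \<notin> T" "insert a T \<subseteq> S"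
    for v w a S T
  proof -
    obtain d where d: "d \<in> D" "rainbow_walk G c' w ((+) k ` T) d"
      using step by (auto simp: R_def)
    have "rainbow_walk G c' w ((+) k ` S - {c' {v, w}}) d"
      using that by (intro rainbow_walk_mono[OF d(2)]) auto
    then have "rainbow_walk G c' v ((+) k ` S) d"
      using that simple[of "{v, w}"] by (intro rainbow_walk.step[of v G w]) auto
    then show ?thesis using d by (auto simp: R_def)
  qed
  have R_leg: "R v {leg v d}" if "v \<in> N1" "d \<in> D" "{v, d} \<in> edges G" for v d
    using that by (intro R_step[OF _ c'_leg R_D[where S = "{}"]]) auto

  \<comment> \<open>Routes from the first layer to \<open>D\<close>\<close>
  have short_X: "R v {0}" if "v \<in> X" "H v w" for v w
    using R_leg[of v "foot v"] foot[of v] that X by (auto simp: leg_def split: if_splits)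
  \<comment> \<open>A vertex of \<open>N1\<close> outside \<open>X\<close> is linked by
    \<open>dom\<close>, so all its edges to \<open>D\<close> have relative colour 1.\<close>
  have short_Y: "R v {1}" if "v \<in> N1 - X" for v
    using R_leg[of v "foot v"] foot[of v] that dom[OF that] by (auto simp: leg_def split: if_splits)
  \<comment> \<open>Cross the link, then follow the route of \<open>w\<close>. A common neighbour in
    \<open>N2\<close> sees both sides, so it is mixed and its two edges spend 2 and 3;
    \<open>a < 2\<close> avoids both.\<close>
  have via_link: "R v (insert a {2, 3})"
    if link: "H v w" "w \<in> X \<longleftrightarrow> v \<notin> X" "R w {a}" "a < 2" for v w a
  proof (cases "{v, w} \<in> edges G")
    case True
    then show ?thesis
      using that by (intro R_step[OF True c'_N1 that(3)]) (auto simp: H_def)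
  next
    case False
    then obtain u where u: "u \<in> N2" "{u, v} \<in> edges G" "{u, w} \<in> edges G"
      and vw: "v \<in> N1" "w \<in> N1"
      using link unfolding H_def by blast
    have "mixed u"
      using u vw that(2) unfolding mixed_def by blast
    then have up: "up u v = (if v \<in> X then 2 else 3)" "up u w = (if v \<in> X then 3 else 2)"
      using that(2) by (auto simp: up_def)
    have "R u {a, up u w}"
      using that(4) up by (intro R_step[OF u(3) c'_up that(3)]) (auto simp: u vw)
    then show ?thesis
      using that(4) up u vw c'_up[of u v]
      by (intro R_step[of v u "up u v" "{a, up u w}"]) (auto simp: insert_commute)
  qed
  have long_X: "R v {1, 2, 3}" if v: "v \<in> X" "H v w" for v w
  proof -
    obtain w' where w': "H v w'" "w' \<notin> X"
      using cross v by blast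
    then have "R w' {1}"
      using H_N1 by (intro short_Y) blast
    then show ?thesis
      using via_link[of v w' 1] w' v by simp
  qed
  have long_Y: "R v {0, 2, 3}" if v: "v \<in> N1 - X" for v
  proof -
    obtain w where w: "H v w" "w \<in> X"
      using dom v by blast
    then have "H w v"
      by (simp add: H_sym)
    then show ?thesis
      using via_link[of v w 0] short_X[of w v] w v by simp
  qed
  have unlinked: "R v {0} \<and> R v {1}" if v: "v \<in> N1" "\<nexists>w. H v w" for v
  proof
    show "R v {0}"
      using R_leg[OF v(1) foot[OF v(1)]] v by (simp add: leg_def)
    \<comment> \<open>If \<open>x\<close> were in \<open>N1\<close>, it would be linked to
      \<open>v\<close>; if in \<open>N2\<close>, its other neighbour in \<open>N1\<close> would be.
      So \<open>x\<close> lies in \<open>D\<close>, and not being the foot it gives colour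
      1.\<close>
    obtain x where x: "x \<noteq> foot v" "{v, x} \<in> edges G"
      using nonpendant v by blast
    have "x \<noteq> v"
      using simple[OF x(2)] by auto
    then have "x \<notin> N1"
      using v x by (auto simp: H_def)
    moreover have "x \<notin> N2"
    proof
      assume "x \<in> N2"
      moreover from this obtain y where "y \<in> N1" "y \<noteq> v" "{x, y} \<in> edges G"
        using two_way by blast
      ultimately have "H v y"
        using v x by (auto simp: H_def insert_commute)
      then show False using v by blast
    qed
    ultimately have "x \<in> D"
      using simple[OF x(2)] verts by auto
    then show "R v {1}"
      using R_leg[OF v(1) _ x(2)] v x by (simp add: leg_def)
  qed

  \<comment> \<open>The three types of vertices\<close>
  define left where "left v \<longleftrightarrow> R v {0, 4} \<and> R v {1, 2, 3, 5}" for v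
  define right where "right v \<longleftrightarrow> R v {0, 2, 3, 4} \<and> R v {1, 5}" for v
  define middle where "middle v \<longleftrightarrow> R v {0, 2} \<and> R v {1, 3}" for v
  \<comment> \<open>Linked vertices of \<open>X\<close> are left, those of \<open>N1 - X\<close>
    right, mixed ones middle; an unmixed vertex of \<open>N2\<close> inherits the side of its
    neighbours. Vertices of \<open>D\<close> and unlinked ones are counted as left.\<close>
  have type: "left v \<or> right v \<or> middle v" if v: "v \<in> verts G" for v
  proof -
    consider "v \<in> D" | "v \<in> X" "\<exists>w. H v w" | "v \<in> N1 - X" | "v \<in> N1" "\<nexists>w. H v w"
      | "v \<in> N2" "mixed v" | "v \<in> N2" "\<not> mixed v"
      using v X unfolding verts by blast
    then show ?thesis
    proof cases
      case 1
      then show ?thesis by (simp add: left_def R_D)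
    next
      case 2
      then have "R v {0}" "R v {1, 2, 3}"
        using short_X long_X by blast+
      then show ?thesis
        by (auto simp: left_def elim: R_mono)
    next
      case 3
      then have "R v {1}" "R v {0, 2, 3}"
        using short_Y long_Y by blast+
      then show ?thesis
        by (auto simp: right_def elim: R_mono)
    next
      case 4
      then have "R v {0}" "R v {1}"
        using unlinked by blast+
      then show ?thesis
        by (auto simp: left_def elim: R_mono)
    next
      case 5
      then obtain x y where xy: "x \<in> X" "{v, x} \<in> edges G" "y \<in> N1 - X" "{v, y} \<in> edges G"
        unfolding mixed_def by blast
      then have "H x y"
        using 5 X by (auto simp: H_def)
      then have "R x {0}" "R y {1}"
        using short_X short_Y xy by blast+
      moreover have "c' {v, x} = k + 2" "c' {v, y} = k + 3"
        using c'_up 5 xy X by (auto simp: up_def)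
      ultimately have "R v {0, 2}" "R v {1, 3}"
        using R_step[OF xy(2), of 2 "{0}"] R_step[OF xy(4), of 3 "{1}"] by simp_all
      then have "middle v"
        by (simp add: middle_def)
      then show ?thesis by simp
    next
      case 6
      obtain b where b: "b \<in> N1" "b \<noteq> anchor v" "{v, b} \<in> edges G"
        using two_way 6 by blast
      note a = anchor[OF 6(1)]
      have col: "c' {v, anchor v} = k + 4" "c' {v, b} = k + 5"
        using c'_up 6 a b by (auto simp: up_def)
      \<comment> \<open>The common neighbour witnessing this link is \<open>v\<close>
        itself.\<close>
      have H: "H (anchor v) b" "H b (anchor v)"
        using 6 a b by (auto simp: H_def)
      have same: "anchor v \<in> X \<longleftrightarrow> b \<in> X"
        using 6 a b unfolding mixed_def by blast
      show ?thesis
      \<comment> \<open>Colour 4 extends the route containing 0 through the anchor, colour 5 the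
        route containing 1 through \<open>b\<close>; the side decides which of them is
        short.\<close>
      proof (cases "b \<in> X")
        case True
        then have "R (anchor v) {0}" "R b {1, 2, 3}"
          using short_X long_X H same by blast+
        then have "left v"
          using R_step[OF a(2) col(1), of "{0}"] R_step[OF b(3) col(2), of "{1, 2, 3}"]
          by (simp add: left_def)
        then show ?thesis by simp
      next
        case False
        then have "R (anchor v) {0, 2, 3}" "R b {1}"
          using short_Y long_Y a b same by blast+
        then have "right v"
          using R_step[OF a(2) col(1), of "{0, 2, 3}"] R_step[OF b(3) col(2), of "{1}"]
          by (simp add: right_def)
        then show ?thesis by simp
      qed
    qed
  qed

  \<comment> \<open>Joining two vertices through \<open>D\<close>\<close>
  have join: "\<exists>p. is_path G u p v \<and> distinct (map c' (path_edges p))"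
    if RR: "R u S" "R v T" "S \<inter> T = {}" for u v S T
  proof -
    obtain d where d: "d \<in> D" "rainbow_walk G c' u ((+) k ` S) d"
      using RR by (auto simp: R_def)
    obtain d' where d': "d' \<in> D" "rainbow_walk G c' v ((+) k ` T) d'"
      using RR by (auto simp: R_def)
    obtain p where p: "is_path (induced_subgraph G D) d p d'" "distinct (map c (path_edges p))"
      using c(2) d d' by (auto simp: rainbow_connected_def induced_subgraph_def)
    have eq: "map c' (path_edges p) = map c (path_edges p)"
      using p(1) by (intro map_cong refl c'_D) (auto simp: is_path_def induced_subgraph_def)
    have "c' ` set (path_edges p) = c ` set (path_edges p)"
      using eq by (metis set_map)
    also have "\<dots> \<subseteq> {..<k}"
      using c(1) p(1) by (auto simp: is_path_def)
    finally have low: "c' ` set (path_edges p) \<subseteq> {..<k}" .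
    have "rainbow_walk G c' (hd p) (c' ` set (path_edges p)) (last p)"
    proof (rule rainbow_path_imp_walk)
      show "distinct (map c' (path_edges p))"
        using p(2) by (simp only: eq)
    qed (use p(1) verts in \<open>auto simp: is_path_def induced_subgraph_def\<close>)
    \<comment> \<open>The three palettes are pairwise disjoint: below \<open>k\<close> inside
      \<open>D\<close>, and the shifted \<open>S\<close> and \<open>T\<close> at its two ends. The
      concatenation may revisit vertices and is cut down to a path last.\<close>
    then have "rainbow_walk G c' d {..<k} d'"
      using p(1) low by (auto simp: is_path_def intro: rainbow_walk_mono)
    then have "rainbow_walk G c' d ({..<k} \<union> (+) k ` T) v"
      using rainbow_walk_sym[OF d'(2)] by (rule rainbow_walk_trans) auto
    with d(2) have "rainbow_walk G c' u ((+) k ` S \<union> ({..<k} \<union> (+) k ` T)) v"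
      by (rule rainbow_walk_trans) (use RR(3) in auto)
    then show ?thesis
      using rainbow_walk_imp_path by metis
  qed
  \<comment> \<open>The set \<open>{0, 4}\<close> of left misses the second set of every type,
    \<open>{1, 5}\<close> of right misses the first sets of right and middle, and two middle
    vertices take opposite sets.\<close>
  have "\<exists>S T. R u S \<and> R v T \<and> S \<inter> T = {}" if "u \<in> verts G" "v \<in> verts G" for u v
  proof -
    have l: "\<exists>S T. R u S \<and> R v T \<and> S \<inter> T = {}" if "left u" "left v \<or> right v \<or> middle v" for u v
    proof -
      have "R u {0, 4}" "R v {1, 2, 3, 5} \<or> R v {1, 5} \<or> R v {1, 3}"
        using that by (auto simp: left_def right_def middle_def)
      moreover have "{0, 4} \<inter> {1, 2, 3, 5} = ({} :: nat set)" "{0, 4} \<inter> {1, 5} = ({} :: nat set)"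
        "{0, 4} \<inter> {1, 3} = ({} :: nat set)" by auto
      ultimately show ?thesis by blast
    qed
    have r: "\<exists>S T. R u S \<and> R v T \<and> S \<inter> T = {}" if "right u" "right v \<or> middle v" for u v
    proof -
      have "R u {1, 5}" "R v {0, 2, 3, 4} \<or> R v {0, 2}"
        using that by (auto simp: right_def middle_def)
      moreover have "{1, 5} \<inter> {0, 2, 3, 4} = ({} :: nat set)" "{1, 5} \<inter> {0, 2} = ({} :: nat set)"
        by auto
      ultimately show ?thesis by blast
    qed
    have m: "\<exists>S T. R u S \<and> R v T \<and> S \<inter> T = {}" if "middle u" "middle v" for u v
      using that by (intro exI[of _ "{0, 2}"] exI[of _ "{1, 3}"]) (auto simp: middle_def)
    show ?thesis
      using type[OF that(1)] type[OF that(2)] l[of u v] l[of v u] r[of u v] r[of v u] m[of u v]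
      by (metis inf_commute)
  qed
  then have "rainbow_connected G c'"
    unfolding rainbow_connected_def using join by metis
  then show ?thesis
    using range by (intro exI[of _ c']) auto
qed

section \<open>Application to the distance layers of \<open>D\<close>\<close>

theorem theorem5:
  fixes G :: "'a graph" and D :: "'a set"
  assumes "finite_simple_graph G"
    and "connected_two_way_two_step_dominating G D"
  shows "rc G \<le> rc (induced_subgraph G D) + 6"
proof (cases "rc (induced_subgraph G D)")
  \<comment> \<open>Only a finite value needs work, and it is attained by a colouring with colours
    below \<open>k\<close>.\<close>
  case (enat k)
  let ?N1 = "dist_nbhd G 1 D" and ?N2 = "dist_nbhd G 2 D"
  have fin: "finite (verts G)" and simple: "\<And>e. e \<in> edges G \<Longrightarrow> e \<subseteq> verts G \<and> card e = 2"
    using assms(1) by (auto simp: finite_simple_graph_def)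
  have dom: "two_step_dominating G D"
    and pendant: "\<And>v. v \<in> verts G \<Longrightarrow> degree G v = 1 \<Longrightarrow> v \<in> D"
    and two_way: "\<And>v. v \<in> ?N2 \<Longrightarrow> card (neighbours G v \<inter> ?N1) \<ge> 2"
    using assms(2)
    by (auto simp: connected_two_way_two_step_dominating_def two_way_two_step_dominating_def)
  obtain c :: "'a set \<Rightarrow> nat" where c: "c ` edges (induced_subgraph G D) \<subseteq> {..<k}"
    "rainbow_connected (induced_subgraph G D) c"
    using INF_enat_attained[OF enat[unfolded rc_def]] by auto
  have disj: "D \<inter> ?N1 = {}" "D \<inter> ?N2 = {}" "?N1 \<inter> ?N2 = {}"
    using dist_nbhd_disjoint[of 1 G D] dist_nbhd_disjoint[of 2 G D] by (auto simp: dist_nbhd_def)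
  have nonpendant: "\<exists>x. x \<noteq> w \<and> {v, x} \<in> edges G" if v: "v \<in> ?N1" for v w
  proof -
    have vG: "v \<in> verts G" "v \<notin> D"
      using v disj by (auto simp: dist_nbhd_def)
    obtain d where d: "d \<in> D" "{v, d} \<in> edges G"
      using dist_nbhd_1_adjacent[OF v] by blast
    then have "d \<in> neighbours G v"
      using simple[of "{v, d}"] by (auto simp: neighbours_def)
    moreover have "finite (neighbours G v)"
      using fin by (simp add: neighbours_def)
    ultimately have "degree G v \<noteq> 0"
      by (auto simp: degree_def)
    \<comment> \<open>Degree 1 is excluded because pendant vertices lie in \<open>D\<close> and
      \<open>v\<close> does not.\<close>
    then have "card (neighbours G v) \<ge> 2"
      using pendant[of v] vG by (fastforce simp: degree_def)
    then show ?thesis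
      using two_distinct_elements[of "neighbours G v" w] by (auto simp: neighbours_def)
  qed
  have "\<exists>c' :: 'a set \<Rightarrow> nat. c' ` edges G \<subseteq> {..<k + 6} \<and> rainbow_connected G c'"
  proof (rule layered_rainbow_colouring[OF two_step_dominating_verts[OF dom] disj _ simple _ _ _ c])
    show "finite ?N1"
      using fin by (simp add: dist_nbhd_def)
    show "\<exists>x\<in>?N1. x \<noteq> w \<and> {u, x} \<in> edges G" if "u \<in> ?N2" for u w
      using two_distinct_elements[OF two_way[OF that], of w] by (auto simp: neighbours_def)
  qed (auto intro: nonpendant dist_nbhd_1_adjacent)
  then have "rc G \<le> enat (k + 6)"
    unfolding rc_def by (intro INF_lower) simp
  then show ?thesis
    by (simp add: enat numeral_eq_enat)
qed simp

end
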